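(* Let $\lambda\in\mathbb{C}$ with $|\lambda|<1$, let $\phi\in H^2(\mathbb{D})$, and let $T=R_\lambda\phi(B)$ be an extended $\lambda$-eigenoperator of $B$ on $H^2(\mathbb{D})$. If $\phi(0)\neq0$, then $T$ is not supercyclic.
   Context: $\mathbb{D}$ is the open unit disk, $H^2(\mathbb{D})$ the Hardy space with orthonormal basis $(z^n)_{n\ge0}$. $B$ is the backward shift: $B1=0$, $Bz^n=z^{n-1}$ for $n\ge1$. An extended $\lambda$-eigenoperator of $B$ is a bounded operator $X\ne0$ on $H^2(\mathbb{D})$ with $BX=\lambda XB$. For $|\lambda|<1$ these are exactly the operators $R_\lambda\phi(B)$ with $0\neq\phi=\sum_{k\ge0}c_kz^k\in H^2(\mathbb{D})$, where $R_\lambda\phi(B)$ is the bounded operator determined by $R_\lambda\phi(B)z^n=\sum_{k=0}^nc_k\lambda^{n-k}z^{n-k}$ (with $0^0=1$); its adjoint is $f\mapsto\overline{\phi}(z)f(\overline{\lambda}z)$, where $\overline{\phi}(z)=\overline{\phi(\overline{z})}$. A bounded operator $T$ on a Banach space is supercyclic if there is a vector $x$ such that $\{\mu T^nx:\mu\in\mathbb{C},\,n\in\mathbb{N}\}$ is dense. *)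

theory Defs
  imports "HOL-Complex_Analysis.Complex_Analysis"
begin

section \<open>The Hardy space of the unit disk\<close>

definition square_summable :: "(nat \<Rightarrow> complex) \<Rightarrow> bool" where
  "square_summable a \<longleftrightarrow> summable (\<lambda>n. (norm (a n))\<^sup>2)"

lemma square_summable_mult:
  assumes "square_summable a" "square_summable b"
  shows "summable (\<lambda>n. norm (a n * b n))"
proof (rule summable_comparison_test')
  show "summable (\<lambda>n. (norm (a n))\<^sup>2 + (norm (b n))\<^sup>2)"
    using assms unfolding square_summable_def by (rule summable_add)
  fix n :: nat
  have "2 * (norm (a n) * norm (b n)) \<le> (norm (a n))\<^sup>2 + (norm (b n))\<^sup>2"
    using sum_squares_bound[of "norm (a n)" "norm (b n)"] by (simp add: mult.assoc)
  moreover have "0 \<le> norm (a n) * norm (b n)" by simp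
  ultimately have "norm (a n) * norm (b n) \<le> (norm (a n))\<^sup>2 + (norm (b n))\<^sup>2"
    by linarith
  then show "norm (norm (a n * b n)) \<le> (norm (a n))\<^sup>2 + (norm (b n))\<^sup>2"
    by (simp add: norm_mult)
qed

lemma square_summable_add:
  assumes "square_summable a" "square_summable b"
  shows "square_summable (\<lambda>n. a n + b n)"
  unfolding square_summable_def
proof (rule summable_comparison_test')
  show "summable (\<lambda>n. 2 * (norm (a n))\<^sup>2 + 2 * (norm (b n))\<^sup>2)"
    using assms unfolding square_summable_def by (intro summable_add summable_mult)
  fix n :: nat
  have "(norm (a n + b n))\<^sup>2 \<le> (norm (a n) + norm (b n))\<^sup>2"
    by (intro power_mono norm_triangle_ineq) auto
  also have "\<dots> \<le> 2 * (norm (a n))\<^sup>2 + 2 * (norm (b n))\<^sup>2"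
    using sum_squares_bound[of "norm (a n)" "norm (b n)"] by (simp add: power2_sum)
  finally show "norm ((norm (a n + b n))\<^sup>2) \<le> 2 * (norm (a n))\<^sup>2 + 2 * (norm (b n))\<^sup>2"
    by simp
qed

lemma square_summable_cmult:
  "square_summable a \<Longrightarrow> square_summable (\<lambda>n. c * a n)"
  unfolding square_summable_def by (simp add: norm_mult power_mult_distrib summable_mult)

lemma square_summable_finite:
  "finite {n. a n \<noteq> 0} \<Longrightarrow> square_summable a"
  unfolding square_summable_def by (rule summable_finite) auto

lemma square_summable_shift:
  "square_summable a \<Longrightarrow> square_summable (\<lambda>n. a (n + k))"
  unfolding square_summable_def by (subst summable_iff_shift)

text \<open>
  An element is a function holomorphic on the disk whose Taylor coefficients at the origin are
  square summable.  HOL functions being total, its values outside the disk are fixed to be 0,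
  so that elements are equal iff they agree on the disk.
\<close>

typedef hardy = "{f :: complex \<Rightarrow> complex. f holomorphic_on ball 0 1
    \<and> (\<forall>z. z \<notin> ball 0 1 \<longrightarrow> f z = 0)
    \<and> square_summable (fps_nth (fps_expansion f 0))}"
  morphisms hardy_eval Abs_hardy
proof
  have "fps_expansion (\<lambda>_::complex. 0::complex) 0 = 0"
    by (rule fps_expansion_eqI) auto
  then show "(\<lambda>_. 0) \<in> {f :: complex \<Rightarrow> complex. f holomorphic_on ball 0 1
      \<and> (\<forall>z. z \<notin> ball 0 1 \<longrightarrow> f z = 0) \<and> square_summable (fps_nth (fps_expansion f 0))}"
    by (auto simp: square_summable_def)
qed

definition hardy_coeff :: "hardy \<Rightarrow> nat \<Rightarrow> complex" where
  "hardy_coeff f n = fps_nth (fps_expansion (hardy_eval f) 0) n"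

lemma hardy_eval_holomorphic: "hardy_eval f holomorphic_on ball 0 1"
  using hardy_eval[of f] by simp

lemma hardy_eval_outside: "z \<notin> ball 0 1 \<Longrightarrow> hardy_eval f z = 0"
  using hardy_eval[of f] by simp

lemma hardy_coeff_square_summable: "square_summable (hardy_coeff f)"
  using hardy_eval[of f] by (simp add: hardy_coeff_def[abs_def])

lemma hardy_coeff_deriv: "hardy_coeff f n = (deriv ^^ n) (hardy_eval f) 0 / fact n"
  by (simp add: hardy_coeff_def fps_expansion_def)

lemma hardy_eval_sums:
  assumes "z \<in> ball 0 1"
  shows "(\<lambda>n. hardy_coeff f n * z ^ n) sums hardy_eval f z"
  using holomorphic_power_series[OF hardy_eval_holomorphic assms]
  by (simp add: hardy_coeff_deriv)

lemma hardy_coeff_0: "hardy_coeff f 0 = hardy_eval f 0"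
  by (simp add: hardy_coeff_deriv)

lemma hardy_eqI:
  assumes "\<And>n. hardy_coeff f n = hardy_coeff g n"
  shows "f = g"
proof -
  have "hardy_eval f z = hardy_eval g z" for z
  proof (cases "z \<in> ball 0 1")
    case True
    have "hardy_coeff f = hardy_coeff g"
      using assms by blast
    then show ?thesis
      using hardy_eval_sums[OF True, of f] hardy_eval_sums[OF True, of g] sums_unique2 by auto
  qed (simp add: hardy_eval_outside)
  then show ?thesis
    by (metis ext hardy_eval_inject)
qed

text \<open>The element with a given square summable sequence of Taylor coefficients.\<close>

definition hardy_of_coeffs :: "(nat \<Rightarrow> complex) \<Rightarrow> hardy" where
  "hardy_of_coeffs a = Abs_hardy (\<lambda>z. if z \<in> ball 0 1 then (\<Sum>n. a n * z ^ n) else 0)"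

lemma hardy_of_coeffs_aux:
  assumes a: "square_summable a"
  defines "f \<equiv> (\<lambda>z::complex. if z \<in> ball 0 1 then (\<Sum>n. a n * z ^ n) else 0)"
  shows "f holomorphic_on ball 0 1" "fps_expansion f 0 = Abs_fps a"
proof -
  have sums: "(\<lambda>n. a n * (z - 0) ^ n) sums f z" if "z \<in> ball 0 1" for z
  proof -
    have "norm z < 1" using that by simp
    then have "(norm z)\<^sup>2 < 1"
      by (simp add: abs_square_less_1)
    moreover have "(norm (z ^ n))\<^sup>2 = ((norm z)\<^sup>2) ^ n" for n
      unfolding norm_power by (metis power_mult mult.commute)
    ultimately have "square_summable (\<lambda>n. z ^ n)"
      unfolding square_summable_def by (simp only:) (rule summable_geometric, simp)
    from square_summable_mult[OF a this] have "summable (\<lambda>n. a n * z ^ n)"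
      by (rule summable_norm_cancel)
    then show ?thesis
      using that by (simp add: f_def summable_sums)
  qed
  show holo: "f holomorphic_on ball 0 1"
    using sums by (rule power_series_holomorphic)
  have "f has_fps_expansion Abs_fps a"
  proof (rule has_fps_expansionI)
    have "eventually (\<lambda>z. z \<in> ball 0 1) (nhds (0::complex))"
      by (intro eventually_nhds_in_open) auto
    then show "\<forall>\<^sub>F u in nhds 0. (\<lambda>n. fps_nth (Abs_fps a) n * u ^ n) sums f u"
      by eventually_elim (use sums in auto)
  qed
  then show "fps_expansion f 0 = Abs_fps a"
    by (rule fps_expansion_eqI)
qed

lemma hardy_coeff_of_coeffs:
  assumes "square_summable a"
  shows "hardy_coeff (hardy_of_coeffs a) = a"
proof -
  have "hardy_eval (hardy_of_coeffs a) = (\<lambda>z. if z \<in> ball 0 1 then (\<Sum>n. a n * z ^ n) else 0)"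
    unfolding hardy_of_coeffs_def
    using hardy_of_coeffs_aux[OF assms] assms
    by (intro Abs_hardy_inverse) (auto simp: fps_nth_Abs_fps[abs_def] fun_eq_iff)
  then show ?thesis
    using hardy_of_coeffs_aux(2)[OF assms] by (auto simp: hardy_coeff_def)
qed

text \<open>The vector space operations are the pointwise ones.\<close>

instantiation hardy :: real_vector
begin

definition zero_hardy :: hardy where "zero_hardy = Abs_hardy (\<lambda>_. 0)"
definition plus_hardy :: "hardy \<Rightarrow> hardy \<Rightarrow> hardy" where
  "plus_hardy f g = Abs_hardy (\<lambda>z. hardy_eval f z + hardy_eval g z)"
definition uminus_hardy :: "hardy \<Rightarrow> hardy" where
  "uminus_hardy f = Abs_hardy (\<lambda>z. - hardy_eval f z)"
definition minus_hardy :: "hardy \<Rightarrow> hardy \<Rightarrow> hardy" where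
  "minus_hardy f g = Abs_hardy (\<lambda>z. hardy_eval f z - hardy_eval g z)"
definition scaleR_hardy :: "real \<Rightarrow> hardy \<Rightarrow> hardy" where
  "scaleR_hardy r f = Abs_hardy (\<lambda>z. complex_of_real r * hardy_eval f z)"

lemma hardy_lincomb_mem:
  "(\<lambda>z. c * hardy_eval f z + d * hardy_eval g z) \<in> {f :: complex \<Rightarrow> complex.
    f holomorphic_on ball 0 1 \<and> (\<forall>z. z \<notin> ball 0 1 \<longrightarrow> f z = 0)
    \<and> square_summable (fps_nth (fps_expansion f 0))}" (is "?h \<in> _")
proof -
  have hol: "?h holomorphic_on ball 0 1"
    by (intro holomorphic_intros hardy_eval_holomorphic)
  have fe: "hardy_eval f has_fps_expansion fps_expansion (hardy_eval f) 0" for f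
    by (rule has_fps_expansion_fps_expansion[of "ball 0 1"]) (auto intro: hardy_eval_holomorphic)
  have "?h has_fps_expansion fps_const c * fps_expansion (hardy_eval f) 0
      + fps_const d * fps_expansion (hardy_eval g) 0"
    by (intro fps_expansion_intros fe)
  then have "fps_expansion ?h 0 = fps_const c * fps_expansion (hardy_eval f) 0
      + fps_const d * fps_expansion (hardy_eval g) 0"
    by (rule fps_expansion_eqI)
  then have "fps_nth (fps_expansion ?h 0) = (\<lambda>n. c * hardy_coeff f n + d * hardy_coeff g n)"
    by (auto simp: hardy_coeff_def)
  then have "square_summable (fps_nth (fps_expansion ?h 0))"
    by (simp add: square_summable_add square_summable_cmult hardy_coeff_square_summable)
  with hol show ?thesis
    by (auto simp: hardy_eval_outside)
qed

lemma hardy_eval_zero [simp]: "hardy_eval 0 = (\<lambda>_. 0)"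
  unfolding zero_hardy_def using hardy_lincomb_mem[of 0 undefined 0 undefined]
  by (intro Abs_hardy_inverse) simp

lemma hardy_eval_plus: "hardy_eval (f + g) = (\<lambda>z. hardy_eval f z + hardy_eval g z)"
  unfolding plus_hardy_def using hardy_lincomb_mem[of 1 f 1 g]
  by (intro Abs_hardy_inverse) simp

lemma hardy_eval_uminus: "hardy_eval (- f) = (\<lambda>z. - hardy_eval f z)"
  unfolding uminus_hardy_def using hardy_lincomb_mem[of "-1" f 0 f]
  by (intro Abs_hardy_inverse) simp

lemma hardy_eval_minus: "hardy_eval (f - g) = (\<lambda>z. hardy_eval f z - hardy_eval g z)"
  unfolding minus_hardy_def using hardy_lincomb_mem[of 1 f "-1" g]
  by (intro Abs_hardy_inverse) simp

lemma hardy_eval_scaleR: "hardy_eval (r *\<^sub>R f) = (\<lambda>z. complex_of_real r * hardy_eval f z)"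
  unfolding scaleR_hardy_def using hardy_lincomb_mem[of "complex_of_real r" f 0 f]
  by (intro Abs_hardy_inverse) simp

instance
  by standard
    (auto simp: hardy_eval_inject[symmetric] hardy_eval_plus hardy_eval_uminus hardy_eval_minus
      hardy_eval_scaleR algebra_simps)

end

definition hardy_scaleC :: "complex \<Rightarrow> hardy \<Rightarrow> hardy" (infixr \<open>*\<^sub>C\<close> 75) where
  "c *\<^sub>C f = Abs_hardy (\<lambda>z. c * hardy_eval f z)"

lemma hardy_eval_scaleC: "hardy_eval (c *\<^sub>C f) = (\<lambda>z. c * hardy_eval f z)"
  unfolding hardy_scaleC_def using hardy_lincomb_mem[of c f 0 f]
  by (intro Abs_hardy_inverse) simp

lemma hardy_scaleR_scaleC: "r *\<^sub>R f = complex_of_real r *\<^sub>C f"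
  by (simp add: hardy_eval_inject[symmetric] hardy_eval_scaleR hardy_eval_scaleC)

interpretation hardy_vs: vector_space hardy_scaleC
  by standard
    (auto simp: hardy_eval_inject[symmetric] hardy_eval_plus hardy_eval_scaleC algebra_simps)

lemma hardy_coeff_plus: "hardy_coeff (f + g) n = hardy_coeff f n + hardy_coeff g n"
  by (simp add: hardy_coeff_deriv hardy_eval_plus add_divide_distrib
      higher_deriv_add[of _ "ball 0 1"] hardy_eval_holomorphic)

lemma hardy_coeff_scaleC: "hardy_coeff (c *\<^sub>C f) n = c * hardy_coeff f n"
  by (simp add: hardy_coeff_deriv hardy_eval_scaleC
      higher_deriv_cmult[of _ "ball 0 1"] hardy_eval_holomorphic)

lemma hardy_coeff_scaleR: "hardy_coeff (r *\<^sub>R f) n = complex_of_real r * hardy_coeff f n"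
  by (simp add: hardy_scaleR_scaleC hardy_coeff_scaleC)

lemma hardy_coeff_zero: "hardy_coeff 0 n = 0"
  using hardy_coeff_scaleC[of 0 0 n] by simp

lemma hardy_coeff_sum: "hardy_coeff (sum f A) n = (\<Sum>i\<in>A. hardy_coeff (f i) n)"
  by (induction A rule: infinite_finite_induct) (auto simp: hardy_coeff_zero hardy_coeff_plus)

lemma hardy_inner_summable:
  "summable (\<lambda>n. hardy_coeff f n * cnj (hardy_coeff g n))"
proof (rule summable_norm_cancel)
  show "summable (\<lambda>n. norm (hardy_coeff f n * cnj (hardy_coeff g n)))"
    using square_summable_mult[OF hardy_coeff_square_summable[of f], of "hardy_coeff g"]
    by (simp add: norm_mult hardy_coeff_square_summable)
qed

text \<open>
  The library has real inner product spaces only: \<open>inner\<close> is the real part of the complex inner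
  product for which the monomials are orthonormal; the norm and the topology are the same.
\<close>

definition hardy_cinner :: "hardy \<Rightarrow> hardy \<Rightarrow> complex" where
  "hardy_cinner f g = (\<Sum>n. hardy_coeff f n * cnj (hardy_coeff g n))"

instantiation hardy :: real_inner
begin

definition inner_hardy :: "hardy \<Rightarrow> hardy \<Rightarrow> real" where
  "inner_hardy f g = Re (hardy_cinner f g)"
definition norm_hardy :: "hardy \<Rightarrow> real" where
  "norm_hardy f = sqrt (\<Sum>n. (norm (hardy_coeff f n))\<^sup>2)"
definition sgn_hardy :: "hardy \<Rightarrow> hardy" where
  "sgn_hardy f = f /\<^sub>R norm f"
definition dist_hardy :: "hardy \<Rightarrow> hardy \<Rightarrow> real" where
  "dist_hardy f g = norm (f - g)"
definition uniformity_hardy :: "(hardy \<times> hardy) filter" where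
  "uniformity_hardy = (INF e\<in>{0<..}. principal {(x, y). dist x y < e})"
definition open_hardy :: "hardy set \<Rightarrow> bool" where
  "open_hardy U \<longleftrightarrow> (\<forall>x\<in>U. eventually (\<lambda>(x', y). x' = x \<longrightarrow> y \<in> U) uniformity)"

lemma hardy_inner_self: "inner f (f::hardy) = (\<Sum>n. (norm (hardy_coeff f n))\<^sup>2)"
proof -
  have "hardy_coeff f n * cnj (hardy_coeff f n) = complex_of_real ((norm (hardy_coeff f n))\<^sup>2)" for n
    by (simp add: complex_norm_square del: of_real_power)
  moreover have "summable (\<lambda>n. (norm (hardy_coeff f n))\<^sup>2)"
    using hardy_coeff_square_summable[of f] by (simp add: square_summable_def)
  ultimately show ?thesis
    unfolding inner_hardy_def hardy_cinner_def by (simp add: suminf_of_real[symmetric] del: of_real_power)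
qed

instance
proof
  fix f g h :: hardy and r :: real
  have sm: "summable (\<lambda>n. (norm (hardy_coeff f n))\<^sup>2)"
    using hardy_coeff_square_summable[of f] by (simp add: square_summable_def)
  have "hardy_cinner g f = cnj (hardy_cinner f g)"
    using sums_unique[OF sums_cnj[THEN iffD2, OF summable_sums[OF hardy_inner_summable[of f g]]]]
    unfolding hardy_cinner_def by (simp add: mult.commute)
  then show "inner f g = inner g f"
    by (simp add: inner_hardy_def)
  show "inner (f + g) h = inner f h + inner g h"
    by (simp add: inner_hardy_def hardy_cinner_def hardy_coeff_plus distrib_right
        suminf_add[OF hardy_inner_summable hardy_inner_summable, symmetric])
  show "inner (r *\<^sub>R f) g = r * inner f g"
    by (simp add: inner_hardy_def hardy_cinner_def hardy_coeff_scaleR mult.assoc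
        suminf_mult[OF hardy_inner_summable])
  show "0 \<le> inner f f"
    unfolding hardy_inner_self by (rule suminf_nonneg[OF sm]) auto
  show "inner f f = 0 \<longleftrightarrow> f = 0"
    unfolding hardy_inner_self using suminf_eq_zero_iff[OF sm]
    by (auto simp: hardy_coeff_zero intro: hardy_eqI)
  show "norm f = sqrt (inner f f)"
    by (simp add: hardy_inner_self norm_hardy_def)
qed (rule sgn_hardy_def dist_hardy_def uniformity_hardy_def open_hardy_def)+

end

definition hardy_monom :: "nat \<Rightarrow> hardy" where
  "hardy_monom n = Abs_hardy (\<lambda>z. if z \<in> ball 0 1 then z ^ n else 0)"

lemma hardy_monom_eq: "hardy_monom n = hardy_of_coeffs (\<lambda>k. if k = n then 1 else 0)"
proof -
  have "(\<lambda>z::complex. \<Sum>k. (if k = n then 1 else 0) * z ^ k) = (\<lambda>z. z ^ n)"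
    by (rule ext, subst suminf_finite[of "{n}"]) auto
  from fun_cong[OF this] show ?thesis
    unfolding hardy_monom_def hardy_of_coeffs_def by (simp only:)
qed

lemma hardy_coeff_monom: "hardy_coeff (hardy_monom n) k = (if k = n then 1 else 0)"
  proof -
  have "square_summable (\<lambda>k. if k = n then 1 else 0)"
    by (rule square_summable_finite) auto
  then show ?thesis
    by (simp add: hardy_monom_eq hardy_coeff_of_coeffs)
qed

lemma hardy_monom_orthonormal:
  "hardy_cinner (hardy_monom m) (hardy_monom n) = (if m = n then 1 else 0)"
  unfolding hardy_cinner_def
  by (subst suminf_finite[of "{m}"]) (simp_all add: hardy_coeff_monom)

section \<open>Operators\<close>

definition hardy_bounded_op :: "(hardy \<Rightarrow> hardy) \<Rightarrow> bool" where
  "hardy_bounded_op T \<longleftrightarrow> Vector_Spaces.linear hardy_scaleC hardy_scaleC T \<and> bounded_linear T"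

lemma hardy_bounded_opI:
  assumes "\<And>f g. T (f + g) = T f + T g" "\<And>c f. T (c *\<^sub>C f) = c *\<^sub>C T f"
    and "\<And>f. norm (T f) \<le> norm f * K"
  shows "hardy_bounded_op T"
  unfolding hardy_bounded_op_def
proof
  show "Vector_Spaces.linear hardy_scaleC hardy_scaleC T"
    by unfold_locales (use assms(1,2) in auto)
  show "bounded_linear T"
    using assms by (intro bounded_linear_intro[where K = K]) (auto simp: hardy_scaleR_scaleC)
qed

lemma hardy_norm_of_coeffs:
  "square_summable a \<Longrightarrow> norm (hardy_of_coeffs a) = sqrt (\<Sum>n. (norm (a n))\<^sup>2)"
  by (simp add: norm_hardy_def hardy_coeff_of_coeffs)

definition backward_shift :: "hardy \<Rightarrow> hardy" where
  "backward_shift f = hardy_of_coeffs (\<lambda>n. hardy_coeff f (n + 1))"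

lemma hardy_coeff_backward_shift: "hardy_coeff (backward_shift f) n = hardy_coeff f (n + 1)"
  using square_summable_shift[OF hardy_coeff_square_summable, of f 1]
  by (simp add: backward_shift_def hardy_coeff_of_coeffs)

lemma backward_shift_monom:
  "backward_shift (hardy_monom 0) = 0"
  "backward_shift (hardy_monom (Suc n)) = hardy_monom n"
  by (auto intro!: hardy_eqI simp: hardy_coeff_backward_shift hardy_coeff_monom hardy_coeff_zero)

lemma hardy_shift_norm_le:
  "(\<Sum>n. (norm (hardy_coeff f (n + k)))\<^sup>2) \<le> (norm f)\<^sup>2"
proof -
  have sm: "summable (\<lambda>n. (norm (hardy_coeff f n))\<^sup>2)"
    using hardy_coeff_square_summable[of f] by (simp add: square_summable_def)
  have "0 \<le> (\<Sum>i<k. (norm (hardy_coeff f i))\<^sup>2)"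
    by (intro sum_nonneg) auto
  then show ?thesis
    using suminf_split_initial_segment[OF sm, of k] by (simp add: power2_norm_eq_inner hardy_inner_self)
qed

lemma backward_shift_bounded_op: "hardy_bounded_op backward_shift"
proof (rule hardy_bounded_opI[where K = 1])
  fix f
  have "(norm (backward_shift f))\<^sup>2 \<le> (norm f)\<^sup>2"
    using hardy_shift_norm_le[of f 1]
    by (simp add: power2_norm_eq_inner[of "backward_shift f"] hardy_inner_self[of "backward_shift f"]
        hardy_coeff_backward_shift)
  then show "norm (backward_shift f) \<le> norm f * 1"
    by (simp add: power2_le_iff_abs_le)
qed (auto intro!: hardy_eqI simp: hardy_coeff_backward_shift hardy_coeff_plus hardy_coeff_scaleC)

definition extended_eigenoperator :: "complex \<Rightarrow> (hardy \<Rightarrow> hardy) \<Rightarrow> bool" where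
  "extended_eigenoperator lam X \<longleftrightarrow> hardy_bounded_op X \<and> X \<noteq> (\<lambda>f. 0)
     \<and> (\<forall>f. backward_shift (X f) = lam *\<^sub>C X (backward_shift f))"

text \<open>
  \<open>is_R_phi_B lam \<phi> T\<close> states that \<open>T\<close> is the bounded operator \<open>R\<^bsub>lam\<^esub> \<phi>(B)\<close>; for \<open>norm lam < 1\<close>
  there is exactly one such \<open>T\<close>, and it is an extended eigenoperator unless \<open>\<phi> = 0\<close> (proved below).
\<close>

definition is_R_phi_B :: "complex \<Rightarrow> hardy \<Rightarrow> (hardy \<Rightarrow> hardy) \<Rightarrow> bool" where
  "is_R_phi_B lam \<phi> T \<longleftrightarrow> hardy_bounded_op T
     \<and> (\<forall>n. T (hardy_monom n)
          = (\<Sum>k=0..n. (hardy_coeff \<phi> k * lam ^ (n - k)) *\<^sub>C hardy_monom (n - k)))"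

lemma hardy_expansion: "(\<lambda>N. \<Sum>n<N. hardy_coeff f n *\<^sub>C hardy_monom n) \<longlonglongrightarrow> f"
proof -
  define s where "s N = (\<Sum>n<N. hardy_coeff f n *\<^sub>C hardy_monom n)" for N
  have s: "hardy_coeff (s N) n = (if n < N then hardy_coeff f n else 0)" for N n
    by (simp add: s_def hardy_coeff_sum hardy_coeff_scaleC hardy_coeff_monom if_distrib cong: if_cong)
  have d: "hardy_coeff (f - s N) n = (if n < N then 0 else hardy_coeff f n)" for N n
    using hardy_coeff_plus[of "f - s N" "s N" n] by (simp add: s split: if_splits)
  have sm: "summable (\<lambda>n. (norm (hardy_coeff f n))\<^sup>2)" for f
    using hardy_coeff_square_summable[of f] by (simp add: square_summable_def)
  have "norm (f - s N) = sqrt (\<Sum>n. (norm (hardy_coeff f (n + N)))\<^sup>2)" for N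
    using suminf_split_initial_segment[OF sm[of "f - s N"], of N] by (simp add: norm_hardy_def d)
  moreover have "(\<lambda>N. sqrt (\<Sum>n. (norm (hardy_coeff f (n + N)))\<^sup>2)) \<longlonglongrightarrow> sqrt 0"
    by (intro tendsto_real_sqrt suminf_exist_split2[OF sm])
  ultimately have "(\<lambda>N. norm (f - s N)) \<longlonglongrightarrow> 0"
    by simp
  then have "(\<lambda>N. norm (s N - f)) \<longlonglongrightarrow> 0"
    by (simp add: norm_minus_commute)
  then show ?thesis
    unfolding s_def[symmetric] by (simp add: LIM_zero_iff tendsto_norm_zero_iff)
qed

lemma hardy_bounded_op_eqI:
  assumes S: "hardy_bounded_op S" and T: "hardy_bounded_op T"
    and eq: "\<And>n. S (hardy_monom n) = T (hardy_monom n)"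
  shows "S = T"
proof
  fix f
  define s where "s N = (\<Sum>n<N. hardy_coeff f n *\<^sub>C hardy_monom n)" for N
  have lim: "(\<lambda>N. U (s N)) \<longlonglongrightarrow> U f" if "hardy_bounded_op U" for U
    using that hardy_expansion[of f] unfolding hardy_bounded_op_def s_def
    by (auto intro: bounded_linear.tendsto)
  have expand: "U (s N) = (\<Sum>n<N. hardy_coeff f n *\<^sub>C U (hardy_monom n))" if "hardy_bounded_op U" for U N
  proof -
    interpret Vector_Spaces.linear hardy_scaleC hardy_scaleC U
      using that by (simp add: hardy_bounded_op_def)
    show ?thesis by (simp add: s_def sum scale)
  qed
  then have "S (s N) = T (s N)" for N
    by (simp add: expand[OF S] expand[OF T] eq)
  then show "S f = T f"
    using lim[OF S] lim[OF T] LIMSEQ_unique by auto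
qed

lemma square_summable_cauchy_schwarz:
  assumes a: "square_summable a" and b: "square_summable b"
  shows "norm (\<Sum>n. a n * b n) \<le> sqrt (\<Sum>n. (norm (a n))\<^sup>2) * sqrt (\<Sum>n. (norm (b n))\<^sup>2)"
proof -
  define a' b' where "a' n = complex_of_real (norm (a n))" and "b' n = complex_of_real (norm (b n))" for n
  have ab: "square_summable a'" "square_summable b'"
    using a b by (auto simp: square_summable_def a'_def b'_def)
  have sm: "summable (\<lambda>n. norm (a n) * norm (b n))"
    using square_summable_mult[OF a b] by (simp add: norm_mult)
  have "inner (hardy_of_coeffs a') (hardy_of_coeffs b') = (\<Sum>n. norm (a n) * norm (b n))"
    using arg_cong[OF suminf_of_real[OF sm, where 'a = complex], of Re]
    by (simp add: inner_hardy_def hardy_cinner_def hardy_coeff_of_coeffs ab a'_def b'_def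
        flip: of_real_mult)
  moreover have "inner (hardy_of_coeffs a') (hardy_of_coeffs b')
      \<le> norm (hardy_of_coeffs a') * norm (hardy_of_coeffs b')"
    by (rule norm_cauchy_schwarz)
  ultimately have "(\<Sum>n. norm (a n) * norm (b n))
      \<le> sqrt (\<Sum>n. (norm (a n))\<^sup>2) * sqrt (\<Sum>n. (norm (b n))\<^sup>2)"
    by (simp add: hardy_norm_of_coeffs ab a'_def b'_def)
  moreover have "norm (\<Sum>n. a n * b n) \<le> (\<Sum>n. norm (a n) * norm (b n))"
    using summable_norm[of "\<lambda>n. a n * b n"] sm by (simp add: norm_mult)
  ultimately show ?thesis
    by linarith
qed

lemma ex1_R_phi_B:
  assumes lam: "norm lam < 1"
  shows "\<exists>!T. is_R_phi_B lam \<phi> T"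
proof (rule ex_ex1I)
  define c where "c f m = (\<Sum>k. hardy_coeff \<phi> k * hardy_coeff f (k + m))" for f m
  define T where "T f = hardy_of_coeffs (\<lambda>m. lam ^ m * c f m)" for f
  have ss: "square_summable (\<lambda>k. hardy_coeff f (k + m))" for f m
    by (intro square_summable_shift hardy_coeff_square_summable)
  have sm: "summable (\<lambda>k. hardy_coeff \<phi> k * hardy_coeff f (k + m))" for f m
    by (rule summable_norm_cancel[OF square_summable_mult[OF hardy_coeff_square_summable ss]])
  have c_le: "norm (c f m) \<le> norm \<phi> * norm f" for f m
  proof -
    have "norm (c f m) \<le> sqrt (\<Sum>k. (norm (hardy_coeff \<phi> k))\<^sup>2) * sqrt (\<Sum>k. (norm (hardy_coeff f (k + m)))\<^sup>2)"
      unfolding c_def by (rule square_summable_cauchy_schwarz[OF hardy_coeff_square_summable ss])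
    also have "\<dots> \<le> norm \<phi> * norm f"
      using real_sqrt_le_mono[OF hardy_shift_norm_le[of f m]]
      by (auto simp: norm_hardy_def[of \<phi>, symmetric] intro: mult_left_mono)
    finally show ?thesis .
  qed
  have geo: "summable (\<lambda>m. ((norm lam)\<^sup>2) ^ m)"
    using lam by (intro summable_geometric) (simp add: abs_square_less_1)
  have bd: "(norm (lam ^ m * c f m))\<^sup>2 \<le> ((norm lam)\<^sup>2) ^ m * (norm \<phi> * norm f)\<^sup>2" for f m
  proof -
    have "((norm lam)\<^sup>2) ^ m = (norm lam ^ m)\<^sup>2"
      by (metis power_mult mult.commute)
    then show ?thesis
      using power_mono[OF c_le[of f m] norm_ge_zero, of 2]
      by (simp add: norm_mult norm_power power_mult_distrib mult_left_mono)
  qed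
  have sq: "square_summable (\<lambda>m. lam ^ m * c f m)" for f
    unfolding square_summable_def
    by (rule summable_comparison_test'[OF summable_mult2[OF geo]]) (use bd in auto)
  have coeff: "hardy_coeff (T f) m = lam ^ m * c f m" for f m
    by (simp add: T_def hardy_coeff_of_coeffs[OF sq])
  define K where "K = sqrt (\<Sum>m. ((norm lam)\<^sup>2) ^ m)"
  have "norm (T f) \<le> norm f * (norm \<phi> * K)" for f
  proof -
    have "(\<Sum>m. (norm (lam ^ m * c f m))\<^sup>2) \<le> (\<Sum>m. ((norm lam)\<^sup>2) ^ m * (norm \<phi> * norm f)\<^sup>2)"
      by (rule suminf_le[OF bd _ summable_mult2[OF geo]]) (use sq in \<open>simp add: square_summable_def\<close>)
    also have "\<dots> = (\<Sum>m. ((norm lam)\<^sup>2) ^ m) * (norm \<phi> * norm f)\<^sup>2"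
      by (rule suminf_mult2[OF geo, symmetric])
    finally have "sqrt (\<Sum>m. (norm (lam ^ m * c f m))\<^sup>2)
        \<le> sqrt ((\<Sum>m. ((norm lam)\<^sup>2) ^ m) * (norm \<phi> * norm f)\<^sup>2)"
      by (rule real_sqrt_le_mono)
    then show ?thesis
      by (simp add: T_def hardy_norm_of_coeffs[OF sq] real_sqrt_mult K_def mult_ac)
  qed
  moreover have "T (f + g) = T f + T g" for f g
    by (rule hardy_eqI)
      (simp add: coeff c_def hardy_coeff_plus distrib_left suminf_add[OF sm sm, symmetric])
  moreover have "T (a *\<^sub>C f) = a *\<^sub>C T f" for a f
  proof (rule hardy_eqI)
    fix m
    have "c (a *\<^sub>C f) m = a * c f m"
      unfolding c_def suminf_mult[OF sm, symmetric] by (simp add: hardy_coeff_scaleC mult_ac)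
    then show "hardy_coeff (T (a *\<^sub>C f)) m = hardy_coeff (a *\<^sub>C T f) m"
      by (simp add: coeff hardy_coeff_scaleC)
  qed
  ultimately have "hardy_bounded_op T"
    by (intro hardy_bounded_opI)
  moreover have "T (hardy_monom n)
      = (\<Sum>k=0..n. (hardy_coeff \<phi> k * lam ^ (n - k)) *\<^sub>C hardy_monom (n - k))" for n
  proof (rule hardy_eqI)
    fix m
    have "hardy_coeff (T (hardy_monom n)) m
        = lam ^ m * (\<Sum>k\<in>{k. k + m = n}. hardy_coeff \<phi> k)"
      unfolding coeff c_def
      by (subst suminf_finite[of "{k. k + m = n}"])
        (auto simp: hardy_coeff_monom intro: finite_subset[of _ "{..n}"])
    also have "\<dots> = (\<Sum>k=0..n. (hardy_coeff \<phi> k * lam ^ (n - k)) * (if m = n - k then 1 else 0))"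
    proof (cases "m \<le> n")
      case True
      then have "{k. k + m = n} = {n - m}" by auto
      moreover have "(\<Sum>k=0..n. (hardy_coeff \<phi> k * lam ^ (n - k)) * (if m = n - k then 1 else 0))
          = (\<Sum>k=0..n. if k = n - m then hardy_coeff \<phi> k * lam ^ m else 0)"
        using True by (intro sum.cong) auto
      ultimately show ?thesis by (simp add: mult.commute)
    next
      case False
      then have "{k. k + m = n} = {}" by auto
      moreover have "(\<Sum>k=0..n. (hardy_coeff \<phi> k * lam ^ (n - k)) * (if m = n - k then 1 else 0)) = 0"
        using False by (intro sum.neutral) auto
      ultimately show ?thesis by simp
    qed
    finally show "hardy_coeff (T (hardy_monom n)) m
        = hardy_coeff (\<Sum>k=0..n. (hardy_coeff \<phi> k * lam ^ (n - k)) *\<^sub>C hardy_monom (n - k)) m"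
      by (simp add: hardy_coeff_sum hardy_coeff_scaleC hardy_coeff_monom)
  qed
  ultimately show "\<exists>T. is_R_phi_B lam \<phi> T"
    by (auto simp: is_R_phi_B_def)
next
  fix S T assume "is_R_phi_B lam \<phi> S" "is_R_phi_B lam \<phi> T"
  then show "S = T"
    by (intro hardy_bounded_op_eqI) (simp_all add: is_R_phi_B_def)
qed

lemma R_phi_B_extended_eigenoperator:
  assumes R: "is_R_phi_B lam \<phi> T" and "\<phi> \<noteq> 0"
  shows "extended_eigenoperator lam T"
proof -
  have T: "hardy_bounded_op T"
    using R by (simp add: is_R_phi_B_def)
  interpret T: Vector_Spaces.linear hardy_scaleC hardy_scaleC T
    using T by (simp add: hardy_bounded_op_def)
  have monom: "hardy_coeff (T (hardy_monom n)) m
      = (if m \<le> n then hardy_coeff \<phi> (n - m) * lam ^ m else 0)" for n m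
  proof -
    have "hardy_coeff (T (hardy_monom n)) m
        = (\<Sum>k=0..n. hardy_coeff \<phi> k * lam ^ (n - k) * (if m = n - k then 1 else 0))"
      using R by (simp add: is_R_phi_B_def hardy_coeff_sum hardy_coeff_scaleC hardy_coeff_monom)
    also have "\<dots> = (\<Sum>k=0..n. if k = n - m \<and> m \<le> n then hardy_coeff \<phi> (n - m) * lam ^ m else 0)"
      by (intro sum.cong) auto
    finally show ?thesis by (cases "m \<le> n") auto
  qed
  obtain n where "hardy_coeff \<phi> n \<noteq> 0"
    using \<open>\<phi> \<noteq> 0\<close> hardy_eqI[of \<phi> 0] by (auto simp: hardy_coeff_zero)
  then have "T (hardy_monom n) \<noteq> 0"
    using monom[of n 0] hardy_coeff_zero[of 0] by auto
  moreover have "(\<lambda>f. backward_shift (T f)) = (\<lambda>f. T (lam *\<^sub>C backward_shift f))"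
  proof (rule hardy_bounded_op_eqI)
    interpret B: Vector_Spaces.linear hardy_scaleC hardy_scaleC backward_shift
      using backward_shift_bounded_op by (simp add: hardy_bounded_op_def)
    have bl: "bounded_linear T" "bounded_linear backward_shift"
      using T backward_shift_bounded_op by (auto simp: hardy_bounded_op_def)
    have "bounded_linear (\<lambda>f. lam *\<^sub>C f)"
    proof (rule bounded_linear_intro[where K = "norm lam"])
      fix f :: hardy
      have "summable (\<lambda>n. (norm (hardy_coeff f n))\<^sup>2)"
        using hardy_coeff_square_summable[of f] by (simp add: square_summable_def)
      then show "norm (lam *\<^sub>C f) \<le> norm f * norm lam"
        by (simp add: norm_hardy_def hardy_coeff_scaleC norm_mult power_mult_distrib suminf_mult
            real_sqrt_mult mult.commute)
    qed (auto intro!: hardy_eqI simp: hardy_coeff_plus hardy_coeff_scaleC hardy_coeff_scaleR algebra_simps)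
    then have "bounded_linear (\<lambda>f. T (lam *\<^sub>C backward_shift f))"
      using bl by (intro bounded_linear_compose[OF bl(1)] bounded_linear_compose[OF _ bl(2)])
    moreover have "Vector_Spaces.linear hardy_scaleC hardy_scaleC (\<lambda>f. T (lam *\<^sub>C backward_shift f))"
      by unfold_locales
        (simp_all add: B.add B.scale T.add T.scale hardy_vs.scale_right_distrib mult.commute)
    ultimately show "hardy_bounded_op (\<lambda>f. T (lam *\<^sub>C backward_shift f))"
      by (simp add: hardy_bounded_op_def)
    have "Vector_Spaces.linear hardy_scaleC hardy_scaleC (\<lambda>f. backward_shift (T f))"
      by unfold_locales (simp_all add: B.add B.scale T.add T.scale)
    then show "hardy_bounded_op (\<lambda>f. backward_shift (T f))"
      using bounded_linear_compose[OF bl(2,1)] by (simp add: hardy_bounded_op_def)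
    fix n
    show "backward_shift (T (hardy_monom n)) = T (lam *\<^sub>C backward_shift (hardy_monom n))"
      by (cases n) (auto intro!: hardy_eqI simp: hardy_coeff_backward_shift monom backward_shift_monom
          hardy_coeff_zero hardy_coeff_scaleC T.scale T.zero)
  qed
  then have "backward_shift (T f) = lam *\<^sub>C T (backward_shift f)" for f
    by (metis T.scale)
  ultimately show ?thesis
    using T by (auto simp: extended_eigenoperator_def)
qed

definition supercyclic :: "(hardy \<Rightarrow> hardy) \<Rightarrow> bool" where
  "supercyclic T \<longleftrightarrow> (\<exists>f. closure {\<mu> *\<^sub>C (T ^^ n) f | \<mu> n. True} = UNIV)"

end

theory Submission
  imports Defs
begin

text \<open>
  Let \<open>c\<close> be the coefficients of \<open>\<phi>\<close>, so \<open>c 0 \<noteq> 0\<close>. The infinite product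
  \<open>\<Prod>k. \<phi>(lam\<^sup>k z) / c 0\<close> solves \<open>c 0 * P(z) = \<phi>(z) * P(lam z)\<close> and belongs to \<open>H\<^sup>2\<close>; pairing
  with its coefficients gives a bounded functional \<open>u\<close> with \<open>u \<circ> T = c 0 * u\<close>. Since \<open>T\<close> is an
  extended eigenoperator of the backward shift \<open>B\<close>, the functional \<open>v = u \<circ> B\<close> satisfies
  \<open>v \<circ> T = lam * c 0 * v\<close>. Hence along the projective orbit of \<open>f\<close> the ratio of \<open>v\<close> to \<open>u\<close> never
  exceeds its value at \<open>f\<close> in modulus, whereas \<open>u\<close> and \<open>v\<close> are linearly independent.
\<close>

section \<open>Square-summable sequences and convolution\<close>

lemma square_summable_bound:
  assumes "square_summable a"
  shows "norm (a n) \<le> sqrt (\<Sum>k. (norm (a k))\<^sup>2)"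
proof -
  have "(\<Sum>k\<in>{n}. (norm (a k))\<^sup>2) \<le> (\<Sum>k. (norm (a k))\<^sup>2)"
    using assms unfolding square_summable_def by (intro sum_le_suminf) auto
  then show ?thesis
    by (intro real_le_rsqrt) simp
qed

text \<open>Cauchy-Schwarz, with each weight split as \<open>sqrt (w i) * sqrt (w i)\<close> and one
  root given to each factor.\<close>

lemma weighted_sum_square_le:
  fixes w x :: "'a \<Rightarrow> real"
  assumes "\<And>i. i \<in> A \<Longrightarrow> 0 \<le> w i"
  shows "(\<Sum>i\<in>A. w i * x i)\<^sup>2 \<le> (\<Sum>i\<in>A. w i) * (\<Sum>i\<in>A. w i * (x i)\<^sup>2)"
proof -
  have "(\<Sum>i\<in>A. sqrt (w i) * (sqrt (w i) * x i))\<^sup>2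
      \<le> (\<Sum>i\<in>A. (sqrt (w i))\<^sup>2) * (\<Sum>i\<in>A. (sqrt (w i) * x i)\<^sup>2)"
    by (rule Cauchy_Schwarz_ineq_sum)
  also have "(\<Sum>i\<in>A. sqrt (w i) * (sqrt (w i) * x i)) = (\<Sum>i\<in>A. w i * x i)"
    using assms by (intro sum.cong) (auto simp flip: mult.assoc)
  also have "(\<Sum>i\<in>A. (sqrt (w i))\<^sup>2) = (\<Sum>i\<in>A. w i)"
    using assms by (intro sum.cong) auto
  also have "(\<Sum>i\<in>A. (sqrt (w i) * x i)\<^sup>2) = (\<Sum>i\<in>A. w i * (x i)\<^sup>2)"
    using assms by (intro sum.cong) (auto simp: power_mult_distrib)
  finally show ?thesis .
qed

text \<open>The case \<open>\<ell>\<^sup>1 * \<ell>\<^sup>2 \<subseteq> \<ell>\<^sup>2\<close> of Young's convolution inequality.\<close>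

lemma square_summable_convolution:
  assumes q: "summable (\<lambda>n. norm (q n))" and c: "square_summable c"
  shows "square_summable (\<lambda>n. \<Sum>m\<le>n. q m * c (n - m))"
  unfolding square_summable_def
proof (rule summable_comparison_test')
  let ?Q = "\<Sum>n. norm (q n)"
  \<comment> \<open>Up to the factor \<open>?Q\<close>, the majorant is the Cauchy product of the
    norms of \<open>q\<close> and the squared norms of \<open>c\<close>.\<close>
  show "summable (\<lambda>n. ?Q * (\<Sum>m\<le>n. norm (q m) * (norm (c (n - m)))\<^sup>2))"
    using q c unfolding square_summable_def
    by (intro summable_mult summable_Cauchy_product) auto
  fix n :: nat
  have "(norm (\<Sum>m\<le>n. q m * c (n - m)))\<^sup>2 \<le> (\<Sum>m\<le>n. norm (q m) * norm (c (n - m)))\<^sup>2"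
    by (intro power_mono) (auto intro!: order_trans[OF norm_sum] simp: norm_mult)
  also have "\<dots> \<le> (\<Sum>m\<le>n. norm (q m)) * (\<Sum>m\<le>n. norm (q m) * (norm (c (n - m)))\<^sup>2)"
    by (rule weighted_sum_square_le) auto
  also have "\<dots> \<le> ?Q * (\<Sum>m\<le>n. norm (q m) * (norm (c (n - m)))\<^sup>2)"
    by (intro mult_right_mono sum_le_suminf[OF q] sum_nonneg) auto
  finally show "norm ((norm (\<Sum>m\<le>n. q m * c (n - m)))\<^sup>2)
      \<le> ?Q * (\<Sum>m\<le>n. norm (q m) * (norm (c (n - m)))\<^sup>2)"
    by simp
qed

section \<open>Coefficients of the infinite product\<close>

text \<open>The coefficients of the solution \<open>P\<close> of \<open>c 0 * P(z) = \<phi>(z) * P(lam z)\<close> with \<open>P(0) = 1\<close>.\<close>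

fun dilation_coeff :: "complex \<Rightarrow> (nat \<Rightarrow> complex) \<Rightarrow> nat \<Rightarrow> complex" where
  "dilation_coeff lam c n = (if n = 0 then 1
     else (\<Sum>m<n. lam ^ m * dilation_coeff lam c m * c (n - m)) / (c 0 * (1 - lam ^ n)))"

declare dilation_coeff.simps [simp del]

lemma dilation_coeff_0 [simp]: "dilation_coeff lam c 0 = 1"
  by (simp add: dilation_coeff.simps)

text \<open>The bound is uniform in \<open>n\<close>, so it controls all denominators
  \<open>1 - lam ^ n\<close> of \<open>dilation_coeff\<close> at once.\<close>

lemma norm_one_minus_power_ge:
  fixes z :: "'a::real_normed_div_algebra"
  assumes "norm z < 1" "0 < n"
  shows "1 - norm z \<le> norm (1 - z ^ n)"
proof -
  have "norm (z ^ n) \<le> norm z ^ 1"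
    unfolding norm_power using assms by (intro power_decreasing) auto
  then show ?thesis
    using norm_triangle_ineq2[of 1 "z ^ n"] by simp
qed

text \<open>This compares the coefficients of z^n in the functional equation of P. For positive
  \<open>n\<close>, the defining recursion is this identity with the summand \<open>m = n\<close>
  moved to the left.\<close>

lemma dilation_coeff_rec:
  assumes "norm lam < 1" "c 0 \<noteq> 0"
  shows "c 0 * dilation_coeff lam c n = (\<Sum>m\<le>n. lam ^ m * dilation_coeff lam c m * c (n - m))"
proof (cases "n = 0")
  case False
  then have "1 - lam ^ n \<noteq> 0"
    using norm_one_minus_power_ge[of lam n] assms by auto
  then have eq: "c 0 * dilation_coeff lam c n * (1 - lam ^ n)
      = (\<Sum>m<n. lam ^ m * dilation_coeff lam c m * c (n - m))"
    using False assms by (subst dilation_coeff.simps) simp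
  have "c 0 * dilation_coeff lam c n
      = c 0 * dilation_coeff lam c n * (1 - lam ^ n) + lam ^ n * dilation_coeff lam c n * c 0"
    by (simp add: algebra_simps)
  also note eq
  also have "(\<Sum>m<n. lam ^ m * dilation_coeff lam c m * c (n - m)) + lam ^ n * dilation_coeff lam c n * c 0
      = (\<Sum>m<Suc n. lam ^ m * dilation_coeff lam c m * c (n - m))"
    by simp
  finally show ?thesis
    by (simp only: lessThan_Suc_atMost)
qed simp

text \<open>A discrete Gronwall argument: the recursion bounds each coefficient by a multiple of the
  preceding partial sum \<open>S n\<close>, so \<open>S\<close> grows by factors at most
  \<open>1 + C * norm lam ^ n\<close>, whose product converges.\<close>

lemma summable_dilation_coeff:
  assumes lam: "norm lam < 1" and c: "square_summable c" "c 0 \<noteq> 0"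
  shows "summable (\<lambda>n. norm (lam ^ n * dilation_coeff lam c n))"
proof -
  define p where "p = dilation_coeff lam c"
  define S where "S n = (\<Sum>m<n. norm (lam ^ m * p m))" for n
  define M where "M = sqrt (\<Sum>k. (norm (c k))\<^sup>2)"
  \<comment> \<open>\<open>M\<close> bounds the sequence \<open>c\<close>, and
    \<open>norm (c 0) * (1 - norm lam)\<close> bounds the denominators of the recursion from
    below.\<close>
  define C where "C = M / (norm (c 0) * (1 - norm lam))"
  have M: "norm (c n) \<le> M" for n
    unfolding M_def by (rule square_summable_bound[OF c(1)])
  then have M0: "0 \<le> M"
    using norm_ge_zero order_trans by blast
  then have C0: "0 \<le> C"
    using lam by (simp add: C_def)
  have S0: "0 \<le> S n" for n
    unfolding S_def by (intro sum_nonneg) auto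
  have p_le: "norm (p n) \<le> C * S n" if "0 < n" for n
  proof -
    have "norm (\<Sum>m<n. lam ^ m * p m * c (n - m)) \<le> (\<Sum>m<n. norm (lam ^ m * p m) * M)"
      by (rule order_trans[OF norm_sum], rule sum_mono)
        (metis M mult_left_mono norm_ge_zero norm_mult)
    also have "\<dots> = S n * M"
      by (simp add: S_def sum_distrib_right)
    finally have le: "norm (\<Sum>m<n. lam ^ m * p m * c (n - m)) \<le> S n * M" .
    have "norm (p n) = norm (\<Sum>m<n. lam ^ m * p m * c (n - m)) / (norm (c 0) * norm (1 - lam ^ n))"
      using that unfolding p_def by (subst dilation_coeff.simps) (simp add: norm_divide norm_mult)
    also have "\<dots> \<le> S n * M / (norm (c 0) * (1 - norm lam))"
      using lam c norm_one_minus_power_ge[OF lam that] S0 M0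
      by (intro frac_le le mult_left_mono) auto
    finally show ?thesis
      by (simp add: C_def mult.commute)
  qed
  have geo: "summable (\<lambda>m. norm lam ^ m)"
    using lam by (simp add: summable_geometric)
  have S_le: "S n \<le> exp (C * (\<Sum>m<n. norm lam ^ m))" for n
  proof (induction n)
    case (Suc n)
    show ?case
    \<comment> \<open>\<open>p_le\<close> fails at 0, where \<open>p 0 = 1\<close> but the empty sum
      \<open>S 0\<close> is 0.\<close>
    proof (cases "n = 0")
      case True
      then show ?thesis
        using C0 by (simp add: S_def p_def)
    next
      case False
      have "S (Suc n) = S n + norm lam ^ n * norm (p n)"
        by (simp add: S_def norm_mult norm_power)
      also have "\<dots> \<le> S n + norm lam ^ n * (C * S n)"
        using p_le False by (intro add_left_mono mult_left_mono) auto
      also have "\<dots> = S n * (1 + C * norm lam ^ n)"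
        by (simp add: algebra_simps)
      also have "\<dots> \<le> exp (C * (\<Sum>m<n. norm lam ^ m)) * exp (C * norm lam ^ n)"
        using C0 by (intro mult_mono Suc.IH exp_ge_add_one_self) auto
      finally show ?thesis
        by (simp add: exp_add distrib_left)
    qed
  qed (simp add: S_def)
  have "S n \<le> exp (C * (\<Sum>m. norm lam ^ m))" for n
  proof -
    have "(\<Sum>m<n. norm lam ^ m) \<le> (\<Sum>m. norm lam ^ m)"
      by (rule sum_le_suminf[OF geo]) auto
    then show ?thesis
      using S_le[of n] C0 by (meson exp_le_cancel_iff mult_left_mono order_trans)
  qed
  then have "(\<Sum>m\<le>n. norm (lam ^ m * p m)) \<le> exp (C * (\<Sum>m. norm lam ^ m))" for n
    unfolding S_def lessThan_Suc_atMost[symmetric] .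
  then show ?thesis
    unfolding p_def by (intro bounded_imp_summable) auto
qed

text \<open>The right side of \<open>dilation_coeff_rec\<close> convolves an absolutely summable
  sequence with the square-summable \<open>c\<close>.\<close>

lemma square_summable_dilation_coeff:
  assumes lam: "norm lam < 1" and c: "square_summable c" "c 0 \<noteq> 0"
  shows "square_summable (dilation_coeff lam c)"
proof -
  have "inverse (c 0) * (\<Sum>m\<le>n. lam ^ m * dilation_coeff lam c m * c (n - m))
      = dilation_coeff lam c n" for n
    unfolding dilation_coeff_rec[where c = c, OF lam c(2), symmetric] using c(2) by simp
  with square_summable_cmult[OF square_summable_convolution[OF summable_dilation_coeff[OF assms] c(1)],
      of "inverse (c 0)"]
  show ?thesis by (simp only:)
qed

section \<open>Functionals given by the inner product\<close>

lemma hardy_cinner_add: "hardy_cinner (f + g) h = hardy_cinner f h + hardy_cinner g h"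
  by (simp add: hardy_cinner_def hardy_coeff_plus distrib_right
      suminf_add[OF hardy_inner_summable hardy_inner_summable, symmetric])

lemma hardy_cinner_scaleC: "hardy_cinner (a *\<^sub>C f) h = a * hardy_cinner f h"
  by (simp add: hardy_cinner_def hardy_coeff_scaleC mult.assoc suminf_mult[OF hardy_inner_summable])

lemma hardy_cinner_zero: "hardy_cinner 0 h = 0"
  by (simp add: hardy_cinner_def hardy_coeff_zero)

lemma hardy_cinner_sum: "hardy_cinner (sum f A) h = (\<Sum>i\<in>A. hardy_cinner (f i) h)"
  by (induction A rule: infinite_finite_induct) (auto simp: hardy_cinner_zero hardy_cinner_add)

lemma hardy_cinner_monom: "hardy_cinner (hardy_monom n) h = cnj (hardy_coeff h n)"
  unfolding hardy_cinner_def by (subst suminf_finite[of "{n}"]) (simp_all add: hardy_coeff_monom)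

lemma bounded_linear_hardy_cinner: "bounded_linear (\<lambda>f. hardy_cinner f h)"
proof (rule bounded_linear_intro[where K = "norm h"])
  fix f
  have "square_summable (\<lambda>n. cnj (hardy_coeff h n))"
    using hardy_coeff_square_summable[of h] by (simp add: square_summable_def)
  from square_summable_cauchy_schwarz[OF hardy_coeff_square_summable[of f] this]
  show "norm (hardy_cinner f h) \<le> norm f * norm h"
    by (simp add: hardy_cinner_def norm_hardy_def)
qed (simp_all add: hardy_cinner_add hardy_scaleR_scaleC hardy_cinner_scaleC scaleR_conv_of_real)

text \<open>Both sides are linear and continuous in \<open>f\<close>, and the monomials span a dense
  subspace.\<close>

lemma hardy_cinner_eigenfunctional:
  assumes T: "hardy_bounded_op T"
    and eq: "\<And>n. hardy_cinner (T (hardy_monom n)) h = a * hardy_cinner (hardy_monom n) h"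
  shows "hardy_cinner (T f) h = a * hardy_cinner f h"
proof (rule LIMSEQ_unique)
  define s where "s N = (\<Sum>n<N. hardy_coeff f n *\<^sub>C hardy_monom n)" for N
  interpret T: Vector_Spaces.linear hardy_scaleC hardy_scaleC T
    using T by (simp add: hardy_bounded_op_def)
  have s: "s \<longlonglongrightarrow> f"
    unfolding s_def by (rule hardy_expansion)
  have "hardy_cinner (T (s N)) h = a * hardy_cinner (s N) h" for N
    by (simp add: s_def T.sum T.scale hardy_cinner_sum hardy_cinner_scaleC eq sum_distrib_left mult_ac)
  moreover have "(\<lambda>N. hardy_cinner (T (s N)) h) \<longlonglongrightarrow> hardy_cinner (T f) h"
    using T s by (auto simp: hardy_bounded_op_def
        intro!: bounded_linear.tendsto[OF bounded_linear_hardy_cinner]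
        intro: bounded_linear.tendsto)
  ultimately show "(\<lambda>N. a * hardy_cinner (s N) h) \<longlonglongrightarrow> hardy_cinner (T f) h"
    by simp
  show "(\<lambda>N. a * hardy_cinner (s N) h) \<longlonglongrightarrow> a * hardy_cinner f h"
    by (intro tendsto_mult_left bounded_linear.tendsto[OF bounded_linear_hardy_cinner] s)
qed

text \<open>Equivalently, \<open>h\<close> is an eigenvector of the adjoint of \<open>T\<close> for
  the conjugate of \<phi>(0). On monomials the equation is
  \<open>dilation_coeff_rec\<close>.\<close>

lemma R_phi_B_eigenfunctional:
  assumes lam: "norm lam < 1" and R: "is_R_phi_B lam \<phi> T" and \<phi>: "hardy_coeff \<phi> 0 \<noteq> 0"
  obtains h where "hardy_coeff h 0 = 1"
    and "\<And>f. hardy_cinner (T f) h = hardy_coeff \<phi> 0 * hardy_cinner f h"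
proof
  define p where "p = dilation_coeff lam (hardy_coeff \<phi>)"
  \<comment> \<open>The inner product is conjugate linear in its second argument; conjugating here
    makes \<open>hardy_cinner f h\<close> pair \<open>f\<close> with \<open>p\<close>
    itself.\<close>
  define h where "h = hardy_of_coeffs (\<lambda>n. cnj (p n))"
  have "square_summable p"
    unfolding p_def using lam hardy_coeff_square_summable \<phi> by (rule square_summable_dilation_coeff)
  then have h: "hardy_coeff h = (\<lambda>n. cnj (p n))"
    unfolding h_def by (intro hardy_coeff_of_coeffs) (simp add: square_summable_def)
  then show "hardy_coeff h 0 = 1"
    by (simp add: p_def)
  have "hardy_cinner (T (hardy_monom n)) h = hardy_coeff \<phi> 0 * hardy_cinner (hardy_monom n) h" for n
  proof -
    have "hardy_cinner (T (hardy_monom n)) h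
        = (\<Sum>k\<le>n. hardy_coeff \<phi> k * lam ^ (n - k) * p (n - k))"
      using R by (simp add: is_R_phi_B_def hardy_cinner_sum hardy_cinner_scaleC hardy_cinner_monom h
          atMost_atLeast0)
    also have "\<dots> = (\<Sum>m\<le>n. lam ^ m * p m * hardy_coeff \<phi> (n - m))"
      by (rule sum.reindex_bij_witness[of _ "\<lambda>m. n - m" "\<lambda>m. n - m"]) auto
    also have "\<dots> = hardy_coeff \<phi> 0 * p n"
      unfolding p_def by (rule dilation_coeff_rec[where c = "hardy_coeff \<phi>", OF lam \<phi>, symmetric])
    finally show ?thesis
      by (simp add: hardy_cinner_monom h)
  qed
  moreover have "hardy_bounded_op T"
    using R by (simp add: is_R_phi_B_def)
  ultimately show "hardy_cinner (T f) h = hardy_coeff \<phi> 0 * hardy_cinner f h" for f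
    by (rule hardy_cinner_eigenfunctional[rotated])
qed

section \<open>Eigenfunctionals along an orbit\<close>

lemma funpow_eigenfunctional:
  fixes u :: "'a \<Rightarrow> 'b::monoid_mult"
  assumes "\<And>f. u (T f) = a * u f"
  shows "u ((T ^^ n) f) = a ^ n * u f"
  by (induction n) (simp_all add: assms mult.assoc)

theorem theorem5p4:
  fixes lam :: complex and \<phi> :: hardy and T :: "hardy \<Rightarrow> hardy"
  assumes "norm lam < 1"
    and "is_R_phi_B lam \<phi> T"
    and "extended_eigenoperator lam T"
    and "hardy_eval \<phi> 0 \<noteq> 0"
  shows "\<not> supercyclic T"
proof
  define a where "a = hardy_coeff \<phi> 0"
  have "a \<noteq> 0"
    using assms(4) by (simp add: a_def hardy_coeff_0)
  then obtain h where h0: "hardy_coeff h 0 = 1"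
    and h: "\<And>f. hardy_cinner (T f) h = a * hardy_cinner f h"
    using R_phi_B_eigenfunctional[OF assms(1,2)] unfolding a_def by blast
  define u where "u f = hardy_cinner f h" for f
  define v where "v f = u (backward_shift f)" for f
  interpret B: Vector_Spaces.linear hardy_scaleC hardy_scaleC backward_shift
    using backward_shift_bounded_op by (simp add: hardy_bounded_op_def)
  have u_lin: "u (f + g) = u f + u g" "u (c *\<^sub>C f) = c * u f" for f g c
    by (simp_all add: u_def hardy_cinner_add hardy_cinner_scaleC)
  have v_lin: "v (f + g) = v f + v g" "v (c *\<^sub>C f) = c * v f" for f g c
    by (simp_all add: v_def u_lin B.add B.scale)
  have uT: "u (T f) = a * u f" for f
    by (simp add: u_def h)
  have vT: "v (T f) = lam * a * v f" for f
    using assms(3) by (simp add: v_def extended_eigenoperator_def u_lin uT)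
  have cont: "continuous_on UNIV u" "continuous_on UNIV v"
    using bounded_linear_hardy_cinner backward_shift_bounded_op
    unfolding v_def u_def hardy_bounded_op_def
    by (auto intro!: linear_continuous_on bounded_linear_compose[OF bounded_linear_hardy_cinner])

  assume "supercyclic T"
  then obtain f where f: "closure {\<mu> *\<^sub>C (T ^^ n) f | \<mu> n. True} = UNIV"
    by (auto simp: supercyclic_def)
  \<comment> \<open>By density, a closed condition satisfied on the projective orbit holds
    everywhere.\<close>
  have closed_UNIV: "x \<in> X"
    if "closed X" "\<And>\<mu> n. \<mu> *\<^sub>C (T ^^ n) f \<in> X" for X x
  proof -
    have "closure {\<mu> *\<^sub>C (T ^^ n) f | \<mu> n. True} \<subseteq> X"
      using that by (intro closure_minimal) auto
    with f show ?thesis by auto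
  qed
  have orbit: "u (\<mu> *\<^sub>C (T ^^ n) f) = \<mu> * a ^ n * u f"
    "v (\<mu> *\<^sub>C (T ^^ n) f) = lam ^ n * (\<mu> * a ^ n * v f)" for \<mu> n
    by (simp_all add: u_lin v_lin funpow_eigenfunctional[of u, OF uT]
        funpow_eigenfunctional[of v, OF vT] power_mult_distrib mult_ac)
  \<comment> \<open>\<open>d\<close> puts \<open>x\<close> in the kernel of \<open>u\<close>, while
    \<open>v x = 1\<close> because the backward shift maps \<open>x\<close> to
    \<open>hardy_monom 0\<close>.\<close>
  define d where "d = - u (hardy_monom 1)"
  define x where "x = hardy_monom 1 + d *\<^sub>C hardy_monom 0"
  have u0: "u (hardy_monom 0) = 1"
    by (simp add: u_def hardy_cinner_monom h0)
  \<comment> \<open>The ratio bound in product form makes sense where \<open>u\<close> vanishes and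
    defines a closed set. At \<open>x\<close> it forces \<open>u f = 0\<close>.\<close>
  have "x \<in> {x. norm (v x) * norm (u f) \<le> norm (u x) * norm (v f)}"
  proof (rule closed_UNIV)
    show "closed {x. norm (v x) * norm (u f) \<le> norm (u x) * norm (v f)}"
      by (intro closed_Collect_le continuous_intros cont)
    fix \<mu> n
    have "norm lam ^ n * (norm (\<mu> * a ^ n) * norm (u f) * norm (v f))
        \<le> 1 * (norm (\<mu> * a ^ n) * norm (u f) * norm (v f))"
      using assms(1) by (intro mult_right_mono) (auto intro: power_le_one)
    then show "\<mu> *\<^sub>C (T ^^ n) f \<in> {x. norm (v x) * norm (u f) \<le> norm (u x) * norm (v f)}"
      by (simp add: orbit norm_mult norm_power mult_ac)
  qed
  moreover have "u x = 0"
    by (simp add: x_def u_lin u0) (simp add: d_def)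
  moreover have "v x = 1"
    using u0 backward_shift_monom(1) backward_shift_monom(2)[of 0]
    by (simp add: x_def v_lin) (simp add: v_def u_def hardy_cinner_zero)
  ultimately have "u f = 0"
    by simp
  \<comment> \<open>Now \<open>u\<close> vanishes on the whole projective orbit, hence everywhere,
    against \<open>u0\<close>.\<close>
  have "hardy_monom 0 \<in> {x. u x = 0}"
    by (rule closed_UNIV) (auto intro!: closed_Collect_eq cont simp: orbit \<open>u f = 0\<close>)
  with u0 show False
    by simp
qed

end
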